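(* Let $G$ be a locally compact abelian group with Haar measure $\mu$, and let $T:L^1(G)\to L^{\infty}(\mathcal{COS}(G))$ be a linear and bounded operator satisfying the cosine convolution property $$T(f\star_{\mathcal{C}} g) = T(f)\,T(g)\qquad\text{for all } f,g\in L^1(G).$$ Then there exists a function $\theta_{\mathcal{C}}:\mathcal{COS}(G)\to\mathcal{COS}(G)\cup\{0\}$ such that $$T(f) = \mathcal{C}(f)\circ\theta_{\mathcal{C}}\qquad\text{for all } f\in L^1(G),$$ where, for $\phi\in\mathcal{COS}(G)$, $\theta_{\mathcal{C}}(\phi)=0$ if and only if $T(f)(\phi)=0$ for every $f\in L^1(G)$.
   Context: $L^1(G)$ is the space of complex-valued $\mu$-integrable functions on $G$ (modulo a.e. equality), and $C^b(G)$ is the space of bounded continuous complex-valued functions on $G$. The set of cosine functions on $G$ is $$\mathcal{COS}(G) := \Big\{\chi\in C^b(G)\ :\ \chi\neq 0,\ \chi(x)\chi(y) = \tfrac{\chi(x+y)+\chi(x-y)}{2}\ \text{for all } x,y\in G\Big\}.$$ The cosine transform of $f\in L^1(G)$ is $\mathcal{C}(f)(\chi) := \int_G f(x)\chi(x)\,d\mu(x)$ for $\chi\in\mathcal{COS}(G)$. The cosine convolution is $$(f\star_{\mathcal{C}} g)(x) := \int_G f(u)\cdot\frac{g(x+u)+g(x-u)}{2}\,d\mu(u),\qquad f,g\in L^1(G).$$ The symbol $0$ in $\mathcal{COS}(G)\cup\{0\}$ denotes the zero function on $G$ (which is not an element of $\mathcal{COS}(G)$), and the formula for $\mathcal{C}$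 is applied to it as well, so $\mathcal{C}(f)(0)=0$ for every $f\in L^1(G)$. Elements of $L^{\infty}(\mathcal{COS}(G))$ are treated as genuine functions with well-defined values at every point: $L^\infty(\mathcal{COS}(G))$ is the space of bounded functions $\mathcal{COS}(G)\to\mathbb{C}$ with the supremum norm, with pointwise multiplication, and equalities in it are understood pointwise. *)

theory Defs
  imports "HOL-Analysis.Analysis"
begin

(* Haar measure as a Borel measure with the usual Radon regularity: no countability assumption is
   made on the group, so outer regularity is required on Borel sets but inner regularity only on
   open sets. *)
definition haar_measure :: "'a::{topological_ab_group_add, t2_space} measure \<Rightarrow> bool" where
  "haar_measure M \<longleftrightarrow>
     sets M = sets borel \<and>
     emeasure M (space M) \<noteq> 0 \<and>
     (\<forall>K. compact K \<longrightarrow> emeasure M K < \<infinity>) \<and>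
     (\<forall>A\<in>sets M. emeasure M A = (INF U\<in>{U. open U \<and> A \<subseteq> U}. emeasure M U)) \<and>
     (\<forall>U. open U \<longrightarrow>
        emeasure M U = (SUP K\<in>{K. compact K \<and> K \<subseteq> U}. emeasure M K)) \<and>
     (\<forall>x. \<forall>A\<in>sets M. emeasure M ((\<lambda>y. x + y) ` A) = emeasure M A)"

(* Representatives: a.e.-equality is not factored out here, but imposed on operators below. *)
definition L1 :: "'a measure \<Rightarrow> ('a \<Rightarrow> complex) set" where
  "L1 M = {f. integrable M f}"

definition L1_norm :: "'a measure \<Rightarrow> ('a \<Rightarrow> complex) \<Rightarrow> real" where
  "L1_norm M f = (\<integral>x. norm (f x) \<partial>M)"

definition COS :: "('a::topological_ab_group_add \<Rightarrow>\<^sub>C complex) set" where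
  "COS = {\<psi>. \<psi> \<noteq> 0 \<and>
     (\<forall>x y. apply_bcontfun \<psi> x * apply_bcontfun \<psi> y =
            (apply_bcontfun \<psi> (x + y) + apply_bcontfun \<psi> (x - y)) / 2)}"

definition cos_transform ::
  "'a::topological_ab_group_add measure \<Rightarrow> ('a \<Rightarrow> complex) \<Rightarrow> ('a \<Rightarrow>\<^sub>C complex) \<Rightarrow> complex" where
  "cos_transform M f \<psi> = (\<integral>x. f x * apply_bcontfun \<psi> x \<partial>M)"

(* For f and g in L1 the integrand is integrable for almost every x; at the remaining points the
   Bochner integral is 0 by convention. *)
definition cos_conv ::
  "'a::topological_ab_group_add measure \<Rightarrow> ('a \<Rightarrow> complex) \<Rightarrow> ('a \<Rightarrow> complex) \<Rightarrow> 'a \<Rightarrow> complex" where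
  "cos_conv M f g x = (\<integral>u. f u * ((g (x + u) + g (x - u)) / 2) \<partial>M)"

(* Bounded linear operators from L1(G), modulo a.e.-equality, to the bounded functions on COS(G)
   with the supremum norm. Values outside L1 or COS are irrelevant. COS contains the constant
   function 1, so the supremum is over a nonempty set. *)
definition bounded_linear_L1_Linf ::
  "'a::topological_ab_group_add measure \<Rightarrow>
     (('a \<Rightarrow> complex) \<Rightarrow> ('a \<Rightarrow>\<^sub>C complex) \<Rightarrow> complex) \<Rightarrow> bool" where
  "bounded_linear_L1_Linf M T \<longleftrightarrow>
     (\<forall>f\<in>L1 M. \<forall>g\<in>L1 M. (AE x in M. f x = g x) \<longrightarrow> (\<forall>\<phi>\<in>COS. T f \<phi> = T g \<phi>)) \<and>
     (\<forall>f\<in>L1 M. \<forall>g\<in>L1 M. \<forall>\<phi>\<in>COS. T (\<lambda>x. f x + g x) \<phi> = T f \<phi> + T g \<phi>) \<and>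
     (\<forall>c. \<forall>f\<in>L1 M. \<forall>\<phi>\<in>COS. T (\<lambda>x. c * f x) \<phi> = c * T f \<phi>) \<and>
     (\<forall>f\<in>L1 M. bounded (T f ` COS)) \<and>
     (\<exists>B. \<forall>f\<in>L1 M. (SUP \<phi>\<in>COS. norm (T f \<phi>)) \<le> B * L1_norm M f)"

end

theory Submission
  imports Defs
begin

text \<open>
  For a fixed \<open>\<phi>\<close> the map \<open>lam f = T f \<phi>\<close> is a bounded linear functional on \<open>L1\<close> that turns cosine
  convolution into multiplication, so the task is to show that a nonzero such functional is
  integration against a cosine function \<open>\<xi>\<close>. Then \<open>\<theta> \<phi>\<close> is this \<open>\<xi>\<close>, or \<open>0\<close> if the functional vanishes.

  Write \<open>S u g x = (g (x + u) + g (x - u)) / 2\<close>. The convolution of \<open>f\<close> and \<open>g\<close> is the superposition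
  \<open>\<integral>u. f u * S u g\<close> of symmetrised translates of \<open>g\<close>, and a bounded functional can be moved under this
  integral:
  \<open>lam f * lam g = \<integral>u. f u * lam (S u g)\<close> (lemma \<open>functional_cos_conv\<close>).
  Choosing \<open>g\<close> with \<open>lam g \<noteq> 0\<close> and dividing gives \<open>lam f = \<integral>u. f u * \<xi> u\<close> with
  \<open>\<xi> u = lam (S u g) / lam g\<close>, which is continuous and bounded. The same identity for any other function
  \<open>h\<close> in place of \<open>g\<close> yields \<open>\<integral>u. f u * (lam (S u h) - \<xi> u * lam h) = 0\<close> for all \<open>f\<close>; hence
  \<open>lam (S u h) = \<xi> u * lam h\<close>, that is, \<open>lam\<close> is a common eigenvector of the operators dual to the \<open>S u\<close>.
  Since \<open>S x (S y g) = (S (x + y) g + S (x - y) g) / 2\<close>, the eigenvalues satisfy the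
  functional equation of the cosine.

  All of this is carried out for continuous functions of compact support. They determine a bounded
  functional on \<open>L1\<close> (lemma \<open>L1_functional_eq_zero\<close>, from the regularity of the measure). The exchange
  of functional and integral (lemma \<open>functional_superpose\<close>) cannot be read off from Fubini's theorem:
  on a group without a countable base \<open>g (x + u)\<close> may fail to be measurable for the product
  of the Borel sigma-algebras. It comes instead from a finite cover of the support of \<open>f\<close>
  by open sets on which the translates \<open>S u g\<close> hardly change in the supremum norm.
\<close>

section \<open>Bounded functionals on the integrable functions\<close>

locale L1_functional =
  fixes M :: "'a measure" and lam :: "('a \<Rightarrow> complex) \<Rightarrow> complex" and B :: real
  assumes add: "f \<in> L1 M \<Longrightarrow> g \<in> L1 M \<Longrightarrow> lam (\<lambda>x. f x + g x) = lam f + lam g"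
    and scale: "f \<in> L1 M \<Longrightarrow> lam (\<lambda>x. c * f x) = c * lam f"
    and bound: "f \<in> L1 M \<Longrightarrow> norm (lam f) \<le> B * L1_norm M f"
    and nonneg: "0 \<le> B"
begin

lemma diff:
  assumes "f \<in> L1 M" "g \<in> L1 M"
  shows "lam (\<lambda>x. f x - g x) = lam f - lam g"
proof -
  have "(\<lambda>x. -1 * g x) \<in> L1 M"
    using assms(2) by (simp add: L1_def)
  from add[OF assms(1) this] scale[OF assms(2), of "-1"] show ?thesis
    by simp
qed

lemma diff_bound:
  assumes "f \<in> L1 M" "g \<in> L1 M"
  shows "norm (lam f - lam g) \<le> B * L1_norm M (\<lambda>x. f x - g x)"
  using bound[of "\<lambda>x. f x - g x"] assms diff[OF assms] by (simp add: L1_def)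

end

lemma L1_norm_mono:
  assumes "integrable M g" "integrable M f" "\<And>x. norm (f x) \<le> g x"
  shows "L1_norm M f \<le> (\<integral>x. g x \<partial>M)"
  unfolding L1_norm_def by (intro integral_mono integrable_norm assms)

lemma norm_integral_mult_le:
  fixes f g :: "'a \<Rightarrow> complex"
  assumes "integrable M f" "integrable M (\<lambda>u. f u * g u)" "\<And>u. f u \<noteq> 0 \<Longrightarrow> norm (g u) \<le> e"
  shows "norm (\<integral>u. f u * g u \<partial>M) \<le> e * L1_norm M f"
proof -
  have "norm (f u * g u) \<le> e * norm (f u)" for u
    using assms(3)[of u] by (cases "f u = 0") (auto simp: norm_mult mult.commute mult_right_mono)
  then have "(\<integral>u. norm (f u * g u) \<partial>M) \<le> (\<integral>u. e * norm (f u) \<partial>M)"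
    using assms by (intro integral_mono integrable_norm integrable_mult_right) auto
  then show ?thesis
    using order.trans[OF integral_norm_bound[of M "\<lambda>u. f u * g u"]] by (simp add: L1_norm_def)
qed

section \<open>Continuous functions of compact support determine a functional\<close>

definition Cc :: "('a::topological_space \<Rightarrow> complex) set" where
  "Cc = {f. continuous_on UNIV f \<and> (\<exists>K. compact K \<and> (\<forall>x. x \<notin> K \<longrightarrow> f x = 0))}"

text \<open>
  The regularity conditions of a Haar measure without the group. Inner regularity is asked
  of open sets only, so sets of finite measure are approximated in two steps, from outside by an
  open set and then from inside by a compact one.
\<close>

locale radon_space =
  fixes M :: "'a::t2_space measure"
  assumes locally_compact: "locally_compact_space (euclidean :: 'a topology)"
    and sets_M [measurable_cong, simp]: "sets M = sets borel"
    and compact_finite: "compact K \<Longrightarrow> emeasure M K < \<infinity>"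
    and outer_regular: "A \<in> sets borel \<Longrightarrow> emeasure M A = (INF U\<in>{U. open U \<and> A \<subseteq> U}. emeasure M U)"
    and inner_regular: "open U \<Longrightarrow> emeasure M U = (SUP K\<in>{K. compact K \<and> K \<subseteq> U}. emeasure M K)"

context radon_space
begin

lemma space_M [simp]: "space M = UNIV"
  using sets_eq_imp_space_eq[OF sets_M] by simp

lemma compact_in_sets [simp]: "compact K \<Longrightarrow> (K :: 'a set) \<in> sets borel"
  by (intro borel_closed compact_imp_closed)

lemma measurable_continuous: "continuous_on UNIV f \<Longrightarrow> f \<in> borel_measurable M"
  using borel_measurable_continuous_onI measurable_cong_sets[OF sets_M refl] by blast

lemma Urysohn_compact_support:
  assumes "compact (K :: 'a set)" "open U" "K \<subseteq> U"
  obtains h L where "continuous_on UNIV h" "\<And>x. 0 \<le> h x" "\<And>x. h x \<le> (1::real)"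
    "\<And>x. x \<in> K \<Longrightarrow> h x = 1" "\<And>x. x \<notin> U \<Longrightarrow> h x = 0" "compact L" "\<And>x. x \<notin> L \<Longrightarrow> h x = 0"
proof -
  have haus: "Hausdorff_space (euclidean :: 'a topology)"
    by (simp add: Hausdorff_space_def) (metis disjnt_def hausdorff)
  obtain V L where V: "open V" "compact L" "K \<subseteq> V" "V \<subseteq> L"
    using iffD1[OF locally_compact_space_compact_closed_compact[OF disjI1[OF haus]] locally_compact,
        rule_format, of K] assms(1) by auto
  have cr: "completely_regular_space (euclidean :: 'a topology)"
    using locally_compact_regular_imp_completely_regular_space locally_compact haus by blast
  have "closedin euclidean (- (U \<inter> V))"
    using assms V by (auto simp: closed_def open_Int simp flip: closed_closedin)
  moreover have "disjnt K (- (U \<inter> V))"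
    using assms V by (auto simp: disjnt_def)
  ultimately obtain h :: "'a \<Rightarrow> real" where h: "continuous_map euclidean (subtopology euclidean {0..1}) h"
      "h ` (- (U \<inter> V)) \<subseteq> {0}" "h ` K \<subseteq> {1}"
    using Urysohn_completely_regular_compact_closed[of 0 1 "euclidean::'a topology" K "- (U \<inter> V)"] cr assms(1)
    by auto
  have "h x \<in> {0..1}" for x
    using h(1) by (auto simp: continuous_map_def)
  moreover have "continuous_on UNIV h"
    using h(1) by (auto simp: continuous_map_in_subtopology)
  ultimately show thesis
    using h(2,3) V by (intro that[of h L]) (auto simp: image_subset_iff)
qed

lemma outer_approx:
  assumes "A \<in> sets borel" "emeasure M A < \<infinity>" "0 < (e::real)"
  obtains U where "open U" "A \<subseteq> U" "emeasure M U < \<infinity>" "measure M U < measure M A + e"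
proof -
  have "emeasure M A < emeasure M A + ennreal e"
    using assms by (simp add: ennreal_add_left_cancel_less[of _ 0, simplified])
  then have "(INF U\<in>{U. open U \<and> A \<subseteq> U}. emeasure M U) < emeasure M A + ennreal e"
    using outer_regular[OF assms(1)] by simp
  then obtain U where U: "open U" "A \<subseteq> U" "emeasure M U < emeasure M A + ennreal e"
    by (auto simp: INF_less_iff)
  have A: "emeasure M A = ennreal (measure M A)"
    using assms by (simp add: emeasure_eq_ennreal_measure)
  have less: "emeasure M U < ennreal (measure M A + e)"
    using U(3) A assms(3) by (simp flip: ennreal_plus)
  then have fin: "emeasure M U < \<infinity>"
    using order.strict_trans by fastforce
  then have "emeasure M U = ennreal (measure M U)"
    by (simp add: emeasure_eq_ennreal_measure)
  with less have "measure M U < measure M A + e"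
    by (simp add: ennreal_less_iff)
  with U fin show thesis by (intro that)
qed

lemma inner_approx:
  assumes "open U" "emeasure M U < \<infinity>" "0 < (e::real)"
  obtains K where "compact K" "K \<subseteq> U" "measure M U - e < measure M K"
proof (cases "measure M U < e")
  case True
  then show thesis by (intro that[of "{}"]) auto
next
  case False
  have "ennreal (measure M U - e) < emeasure M U"
    using False assms by (simp add: emeasure_eq_ennreal_measure ennreal_less_iff)
  then obtain K where K: "compact K" "K \<subseteq> U" "ennreal (measure M U - e) < emeasure M K"
    using inner_regular[OF assms(1)] by (auto simp: less_SUP_iff)
  moreover have "emeasure M K = ennreal (measure M K)"
    using compact_finite[OF K(1)] by (simp add: emeasure_eq_ennreal_measure)
  ultimately show thesis
    using False by (intro that[of K]) (auto simp: ennreal_less_iff)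
qed

lemma integrable_compact_support:
  fixes f :: "'a \<Rightarrow> complex"
  assumes "f \<in> borel_measurable M" "compact K" "\<And>x. x \<notin> K \<Longrightarrow> f x = 0" "\<And>x. x \<in> K \<Longrightarrow> norm (f x) \<le> c"
  shows "f \<in> L1 M" "L1_norm M f \<le> c * measure M K"
proof -
  have int: "integrable M (\<lambda>x. c * indicator K x)"
    using assms(2) compact_finite by (auto intro!: integrable_real_indicator)
  have le: "norm (f x) \<le> c * indicator K x" for x
    using assms(3,4) by (cases "x \<in> K") auto
  show f: "f \<in> L1 M"
    unfolding L1_def using le
    by (auto intro!: Bochner_Integration.integrable_bound[OF int assms(1)] AE_I2 order.trans[OF le] )
  show "L1_norm M f \<le> c * measure M K"
    using L1_norm_mono[OF int _ le] f assms(2) by (simp add: L1_def)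
qed

lemma Cc_subset_L1: "Cc \<subseteq> L1 M"
proof
  fix f :: "'a \<Rightarrow> complex" assume "f \<in> Cc"
  then obtain K where f: "continuous_on UNIV f" "compact K" "\<And>x. x \<notin> K \<Longrightarrow> f x = 0"
    by (auto simp: Cc_def)
  have "bounded (f ` K)"
    using f by (meson compact_continuous_image compact_imp_bounded continuous_on_subset top_greatest)
  then obtain c where "\<And>x. x \<in> K \<Longrightarrow> norm (f x) \<le> c"
    by (auto simp: bounded_iff)
  with f show "f \<in> L1 M"
    using integrable_compact_support(1)[OF measurable_continuous[OF f(1)] f(2,3)] by blast
qed

lemma indicator_in_L1:
  assumes "A \<in> sets borel" "emeasure M A < \<infinity>"
  shows "(indicator A :: 'a \<Rightarrow> complex) \<in> L1 M"
proof -
  have "integrable M (\<lambda>x. indicator A x *\<^sub>R (1 :: complex))"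
    using assms by (intro integrable_indicator) auto
  moreover have "(\<lambda>x. indicator A x *\<^sub>R (1 :: complex)) = indicator A"
    by (auto simp: indicator_def)
  ultimately show ?thesis
    by (simp add: L1_def)
qed

text \<open>
  A Urysohn function between a compact \<open>K\<close> and an open \<open>U\<close>, where \<open>U\<close> contains \<open>A\<close> and all of
  \<open>U - K\<close> and \<open>U - A\<close> have small measure.
\<close>

lemma indicator_approx_Cc:
  assumes A: "A \<in> sets borel" "emeasure M A < \<infinity>" and e: "0 < (e::real)"
  obtains h where "h \<in> Cc" "L1_norm M (\<lambda>x. indicator A x - h x) \<le> e"
proof -
  obtain U where U: "open U" "A \<subseteq> U" "emeasure M U < \<infinity>" "measure M U < measure M A + e/2"
    using outer_approx[OF A half_gt_zero[OF e]] by blast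
  obtain K where K: "compact K" "K \<subseteq> U" "measure M U - e/2 < measure M K"
    using inner_approx[OF U(1,3) half_gt_zero[OF e]] by blast
  obtain h L where h: "continuous_on UNIV h" "\<And>x. 0 \<le> h x" "\<And>x. h x \<le> (1::real)"
    "\<And>x. x \<in> K \<Longrightarrow> h x = 1" "\<And>x. x \<notin> U \<Longrightarrow> h x = 0" "compact L" "\<And>x. x \<notin> L \<Longrightarrow> h x = 0"
    using Urysohn_compact_support[OF K(1) U(1) K(2)] by blast
  define h' where "h' = (\<lambda>x. complex_of_real (h x))"
  have h': "h' \<in> Cc"
    unfolding Cc_def h'_def using h by (auto intro!: continuous_intros)
  have fin: "emeasure M K < \<infinity>"
    using K compact_finite by blast
  have int: "integrable M (indicator A :: 'a \<Rightarrow> real)" "integrable M (indicator U :: 'a \<Rightarrow> real)"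
      "integrable M (indicator K :: 'a \<Rightarrow> real)"
    using A U(1,3) K(1) fin by (auto intro!: integrable_real_indicator)
  \<comment> \<open>Both \<open>indicator A\<close> and \<open>h\<close> lie below \<open>indicator U\<close>, so each is compared with it;
      the distance of \<open>h\<close> is at most that of \<open>indicator K\<close>.\<close>
  have le: "norm (indicator A x - h' x)
      \<le> (indicator U x - indicator A x) + (indicator U x - indicator K x)" for x
  proof -
    have "indicator A x - h' x = complex_of_real (indicator A x - h x)"
      by (simp add: h'_def indicator_def)
    then have "norm (indicator A x - h' x) = \<bar>indicator A x - h x\<bar>"
      by (simp only: norm_of_real)
    then show ?thesis
      using U K h(2)[of x] h(3)[of x] h(4)[of x] h(5)[of x]
      by (auto simp: indicator_def split: if_splits)
  qed
  have "L1_norm M (\<lambda>x. indicator A x - h' x)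
      \<le> (\<integral>x. (indicator U x - indicator A x) + (indicator U x - indicator K x) \<partial>M)"
    using int h' Cc_subset_L1 indicator_in_L1[OF A]
    by (intro L1_norm_mono le) (auto simp: L1_def)
  also have "\<dots> = (measure M U - measure M A) + (measure M U - measure M K)"
    using int by simp
  also have "\<dots> \<le> e"
    using U K by simp
  finally show thesis
    using h' by (intro that)
qed

text \<open>
  The density of \<open>Cc\<close> in \<open>L1\<close>, in the form in which it is applied: once to find a \<open>g\<close> in \<open>Cc\<close> on
  which a nonzero functional does not vanish, once to extend an integral representation from \<open>Cc\<close>
  to \<open>L1\<close>.
\<close>

lemma L1_functional_eq_zero:
  assumes "L1_functional M lam B" and zero: "\<And>h. h \<in> Cc \<Longrightarrow> lam h = 0" and "f \<in> L1 M"
  shows "lam f = 0"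
proof -
  interpret F: L1_functional M lam B by fact
  have "integrable M f"
    using assms(3) by (simp add: L1_def)
  then show ?thesis
  proof (induction rule: integrable_induct)
    case (base A c)
    have A: "indicator A \<in> L1 M"
      using base by (intro indicator_in_L1) auto
    have "(\<lambda>x. indicator A x *\<^sub>R c) = (\<lambda>x. c * indicator A x)"
      by (auto simp: indicator_def)
    then have scaled: "lam (\<lambda>x. indicator A x *\<^sub>R c) = c * lam (indicator A)"
      using F.scale[OF A, of c] by simp
    have "norm (lam (indicator A)) \<le> 0 + e" if "e > 0" for e
    proof -
      have "e / (B + 1) > 0" using that F.nonneg by simp
      then obtain h where h: "h \<in> Cc" "L1_norm M (\<lambda>x. indicator A x - h x) \<le> e / (B + 1)"
        using indicator_approx_Cc[of A "e / (B+1)"] base by auto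
      have "norm (lam (indicator A)) \<le> B * L1_norm M (\<lambda>x. indicator A x - h x)"
        using F.diff_bound[OF A, of h] h(1) zero[OF h(1)] Cc_subset_L1 by auto
      also have "\<dots> \<le> B * (e / (B + 1))"
        using h F.nonneg by (intro mult_left_mono)
      also have "\<dots> \<le> e"
        using that F.nonneg by (simp add: field_simps)
      finally show ?thesis by simp
    qed
    then have "norm (lam (indicator A)) \<le> 0"
      by (rule field_le_epsilon)
    with scaled show ?case by simp
  next
    case (add f g)
    then show ?case using F.add[of f g] by (simp add: L1_def)
  next
    case (lim f s)
    have "(\<lambda>i. \<integral>x. norm (f x - s i x) \<partial>M) \<longlonglongrightarrow> (\<integral>x. 0 \<partial>M)"
    proof (rule integral_dominated_convergence[where w="\<lambda>x. 3 * norm (f x)"])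
      have "(\<lambda>i. norm (f x - s i x)) \<longlonglongrightarrow> 0" for x
        using tendsto_norm[OF tendsto_diff[OF tendsto_const[of "f x"] lim.hyps(2)[of x]]] by simp
      then show "AE x in M. (\<lambda>i. norm (f x - s i x)) \<longlonglongrightarrow> 0" by simp
      show "AE x in M. norm (norm (f x - s i x)) \<le> 3 * norm (f x)" for i
      proof (rule AE_I2)
        fix x show "norm (norm (f x - s i x)) \<le> 3 * norm (f x)"
          using norm_triangle_ineq4[of "f x" "s i x"] lim.hyps(3)[of x i] by simp
      qed
    qed (use lim in \<open>auto intro!: borel_measurable_integrable\<close>)
    then have "(\<lambda>i. B * L1_norm M (\<lambda>x. f x - s i x)) \<longlonglongrightarrow> B * 0"
      unfolding L1_norm_def by (intro tendsto_intros) simp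
    moreover have "norm (lam f) \<le> B * L1_norm M (\<lambda>x. f x - s i x)" for i
      using F.diff_bound[of f "s i"] lim by (simp add: L1_def)
    ultimately have "norm (lam f) \<le> B * 0"
      by (intro LIMSEQ_le_const) auto
    then show ?case by simp
  qed
qed

end

section \<open>Moving a functional under an integral\<close>

text \<open>
  The constant \<open>C\<close> absorbs the norms and measures that multiply \<open>e\<close> in the estimates below.
\<close>

lemma continuous_onI_neighbourhoods:
  fixes f :: "'a::topological_space \<Rightarrow> 'b::real_normed_vector"
  assumes "\<And>x0 e. x0 \<in> S \<Longrightarrow> 0 < e \<Longrightarrow> \<exists>W. open W \<and> x0 \<in> W \<and> (\<forall>x\<in>W \<inter> S. norm (f x - f x0) \<le> C * e)"
  shows "continuous_on S f"
  unfolding continuous_on_def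
proof (intro ballI tendstoI)
  fix x0 and r :: real
  assume "x0 \<in> S" "0 < r"
  define e where "e = r / (\<bar>C\<bar> + 1)"
  have "0 < e" using \<open>0 < r\<close> by (simp add: e_def)
  then obtain W where W: "open W" "x0 \<in> W" "\<And>x. x \<in> W \<inter> S \<Longrightarrow> norm (f x - f x0) \<le> C * e"
    using assms[OF \<open>x0 \<in> S\<close>] by meson
  have "C * e \<le> \<bar>C\<bar> * e"
    using \<open>0 < e\<close> by (intro mult_right_mono) auto
  also have "\<dots> < (\<bar>C\<bar> + 1) * e"
    using \<open>0 < e\<close> by (intro mult_strict_right_mono) auto
  also have "\<dots> = r"
    by (simp add: e_def)
  finally have "dist (f x) (f x0) < r" if "x \<in> W \<inter> S" for x
    using W(3)[OF that] by (simp add: dist_norm)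
  with W show "\<forall>\<^sub>F x in at x0 within S. dist (f x) (f x0) < r"
    by (auto simp: eventually_at_topological)
qed

text \<open>
  This takes the place of uniform continuity: compactness in one variable makes continuity in
  the other uniform.
\<close>

lemma slices_uniformly_close:
  fixes k :: "'a::topological_space \<Rightarrow> 'b::topological_space \<Rightarrow> 'c::real_normed_vector"
  assumes "continuous_on UNIV (\<lambda>(u, x). k u x)" "compact L" "0 < e"
  obtains W where "open W" "u0 \<in> W" "\<And>u x. u \<in> W \<Longrightarrow> x \<in> L \<Longrightarrow> norm (k u x - k u0 x) \<le> e"
proof -
  have "continuous_on (UNIV \<times> L) (\<lambda>(u, x). k u x)"
    using assms(1) continuous_on_subset by blast
  then obtain W where "u0 \<in> W" "open W"
      "\<forall>u\<in>W \<inter> UNIV. \<forall>x\<in>L. dist (case (u, x) of (u, x) \<Rightarrow> k u x) (case (u0, x) of (u, x) \<Rightarrow> k u x) \<le> e"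
    using continuous_on_prod_compactE[OF _ assms(2) UNIV_I assms(3)] by metis
  then show thesis by (intro that[of W]) (auto simp: dist_norm)
qed

context radon_space
begin

lemma integrable_mult_continuous_on_compact:
  fixes f g :: "'a \<Rightarrow> complex"
  assumes f: "integrable M f" and A: "compact A" "\<And>u. u \<notin> A \<Longrightarrow> f u = 0" and g: "continuous_on A g"
  shows "integrable M (\<lambda>u. f u * g u)"
proof -
  define g' where "g' = (\<lambda>u. indicator A u *\<^sub>R g u)"
  have [measurable]: "g' \<in> borel_measurable M"
    using borel_measurable_continuous_on_indicator[OF compact_in_sets[OF A(1)] g]
      measurable_cong_sets[OF sets_M refl] unfolding g'_def by blast
  have [measurable]: "f \<in> borel_measurable M"
    using f by (rule borel_measurable_integrable)
  have "bounded (g ` A)"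
    using g A by (meson compact_continuous_image compact_imp_bounded)
  then obtain c where c: "\<And>x. x \<in> A \<Longrightarrow> norm (g x) \<le> c"
    by (auto simp: bounded_iff)
  have eq: "(\<lambda>u. f u * g u) = (\<lambda>u. f u * g' u)"
    using A(2) by (auto simp: g'_def fun_eq_iff indicator_def)
  have le: "norm (f u * g' u) \<le> norm (complex_of_real c * f u)" for u
  proof (cases "u \<in> A")
    case True
    then have "norm (g u) \<le> \<bar>c\<bar>" using c[of u] by linarith
    then have "norm (f u) * norm (g u) \<le> norm (f u) * \<bar>c\<bar>" by (intro mult_left_mono) auto
    with True show ?thesis by (simp add: g'_def norm_mult mult.commute)
  qed (use A(2) in auto)
  show ?thesis
    unfolding eq
  proof (rule Bochner_Integration.integrable_bound)
    show "integrable M (\<lambda>u. complex_of_real c * f u)" using f by simp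
    show "AE u in M. norm (f u * g' u) \<le> norm (complex_of_real c * f u)" using le by simp
  qed measurable
qed

lemma small_on_compact_bound:
  fixes h :: "'a \<Rightarrow> complex"
  assumes "L1_functional M lam B" "h \<in> borel_measurable M" "compact L"
    "\<And>x. x \<notin> L \<Longrightarrow> h x = 0" "\<And>x. x \<in> L \<Longrightarrow> norm (h x) \<le> e"
  shows "norm (lam h) \<le> B * (e * measure M L)"
proof -
  interpret F: L1_functional M lam B by fact
  show ?thesis
    using F.bound[OF integrable_compact_support(1)[OF assms(2-5)]]
      mult_left_mono[OF integrable_compact_support(2)[OF assms(2-5)] F.nonneg] by simp
qed

end

text \<open>
  A continuous kernel all of whose slices \<open>k u\<close> with \<open>u\<close> in the compact set \<open>A\<close> live on one compact set
  \<open>L\<close>. A common \<open>L\<close> matters because it has finite measure: a bound on such functions in the supremum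
  norm then gives one in the norm of \<open>L1\<close>.
\<close>

locale compact_kernel = radon_space M for M :: "'a::t2_space measure" +
  fixes k :: "'a \<Rightarrow> 'a \<Rightarrow> complex" and A L :: "'a set"
  assumes continuous_kernel: "continuous_on UNIV (\<lambda>(u, x). k u x)"
    and compact_A: "compact A" and compact_L: "compact L"
    and kernel_zero: "u \<in> A \<Longrightarrow> x \<notin> L \<Longrightarrow> k u x = 0"
begin

definition admissible :: "('a \<Rightarrow> complex) \<Rightarrow> bool" where
  "admissible f \<longleftrightarrow> integrable M f \<and> (\<forall>u. u \<notin> A \<longrightarrow> f u = 0)"

definition superpose :: "('a \<Rightarrow> complex) \<Rightarrow> 'a \<Rightarrow> complex" where
  "superpose f = (\<lambda>x. \<integral>u. f u * k u x \<partial>M)"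

lemma continuous_slices: "continuous_on UNIV (k u)" "continuous_on UNIV (\<lambda>u. k u x)"
proof -
  have pair: "continuous_on UNIV (\<lambda>x. (u, x))" "continuous_on UNIV (\<lambda>u. (u, x))"
    by (intro continuous_intros)+
  show "continuous_on UNIV (k u)" "continuous_on UNIV (\<lambda>u. k u x)"
    using continuous_on_compose2[OF continuous_kernel pair(1)]
      continuous_on_compose2[OF continuous_kernel pair(2)] by simp_all
qed

lemma slice_in_Cc: "u \<in> A \<Longrightarrow> k u \<in> Cc"
  using continuous_slices(1) compact_L kernel_zero by (auto simp: Cc_def)

lemma integrable_slice: "admissible f \<Longrightarrow> integrable M (\<lambda>u. f u * k u x)"
  using compact_A continuous_on_subset[OF continuous_slices(2) subset_UNIV]
  by (intro integrable_mult_continuous_on_compact[of f A]) (auto simp: admissible_def)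

lemma superpose_in_Cc:
  assumes f: "admissible f"
  shows "superpose f \<in> Cc"
proof -
  have "continuous_on UNIV (superpose f)"
  proof (rule continuous_onI_neighbourhoods)
    fix x0 and e :: real
    assume "0 < e"
    have "continuous_on UNIV (\<lambda>(x, u). k u x)"
      using continuous_on_swap_args[of UNIV UNIV k] continuous_kernel by simp
    then obtain W where W: "open W" "x0 \<in> W" "\<And>x u. x \<in> W \<Longrightarrow> u \<in> A \<Longrightarrow> norm (k u x - k u x0) \<le> e"
      using slices_uniformly_close[OF _ compact_A \<open>0 < e\<close>] by blast
    have "norm (superpose f x - superpose f x0) \<le> L1_norm M f * e" if "x \<in> W" for x
    proof -
      have "superpose f x - superpose f x0 = (\<integral>u. f u * (k u x - k u x0) \<partial>M)"
        unfolding superpose_def using integrable_slice[OF f] by (simp add: right_diff_distrib)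
      also have "norm \<dots> \<le> e * L1_norm M f"
        using f W(3)[OF that] integrable_slice[OF f]
        by (intro norm_integral_mult_le) (auto simp: admissible_def right_diff_distrib)
      finally show ?thesis by (simp add: mult.commute)
    qed
    with W show "\<exists>W. open W \<and> x0 \<in> W \<and> (\<forall>x\<in>W \<inter> UNIV. norm (superpose f x - superpose f x0) \<le> L1_norm M f * e)"
      by blast
  qed
  moreover have "superpose f x = 0" if "x \<notin> L" for x
  proof -
    have "f u * k u x = 0" for u
      using f kernel_zero[of u x] that by (cases "u \<in> A") (auto simp: admissible_def)
    then show ?thesis
      unfolding superpose_def by (simp only: Bochner_Integration.integral_zero)
  qed
  ultimately show ?thesis
    using compact_L by (auto simp: Cc_def)
qed

lemma functional_slices_close:
  assumes "L1_functional M lam B" "u \<in> A" "u' \<in> A" "\<And>x. x \<in> L \<Longrightarrow> norm (k u x - k u' x) \<le> e"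
  shows "norm (lam (k u) - lam (k u')) \<le> B * (e * measure M L)"
proof -
  interpret F: L1_functional M lam B by fact
  have "lam (\<lambda>x. k u x - k u' x) = lam (k u) - lam (k u')"
    using slice_in_Cc assms(2,3) Cc_subset_L1 by (intro F.diff) auto
  moreover have "norm (lam (\<lambda>x. k u x - k u' x)) \<le> B * (e * measure M L)"
    using assms compact_L kernel_zero continuous_slices(1)
    by (intro small_on_compact_bound measurable_continuous continuous_on_diff) auto
  ultimately show ?thesis by simp
qed

lemma continuous_on_functional_slices:
  assumes "L1_functional M lam B"
  shows "continuous_on A (\<lambda>u. lam (k u))"
proof (rule continuous_onI_neighbourhoods)
  fix u0 and e :: real
  assume "u0 \<in> A" "0 < e"
  obtain W where W: "open W" "u0 \<in> W" "\<And>u x. u \<in> W \<Longrightarrow> x \<in> L \<Longrightarrow> norm (k u x - k u0 x) \<le> e"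
    using slices_uniformly_close[OF continuous_kernel compact_L \<open>0 < e\<close>] by blast
  have "norm (lam (k u) - lam (k u0)) \<le> (B * measure M L) * e" if "u \<in> W \<inter> A" for u
    using functional_slices_close[OF assms, of u u0 e] W(3) that \<open>u0 \<in> A\<close> by (simp add: mult_ac)
  with W show "\<exists>W. open W \<and> u0 \<in> W \<and> (\<forall>u\<in>W \<inter> A. norm (lam (k u) - lam (k u0)) \<le> (B * measure M L) * e)"
    by blast
qed

lemma integrable_functional_slices:
  assumes "L1_functional M lam B" "admissible f"
  shows "integrable M (\<lambda>u. f u * lam (k u))"
  using assms(2) continuous_on_functional_slices[OF assms(1)] compact_A
  by (intro integrable_mult_continuous_on_compact[of f A]) (auto simp: admissible_def)

text \<open>
  The goal is that the defect vanishes. It is additive in \<open>f\<close>, and it is small relative to the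
  norm of \<open>f\<close> if \<open>f\<close> lives where the slices are nearly constant; cutting a general \<open>f\<close> into such
  pieces keeps the relative bound, since their norms add up to that of \<open>f\<close>.
\<close>

definition defect :: "(('a \<Rightarrow> complex) \<Rightarrow> complex) \<Rightarrow> ('a \<Rightarrow> complex) \<Rightarrow> complex" where
  "defect lam f = lam (superpose f) - (\<integral>u. f u * lam (k u) \<partial>M)"

text \<open>
  Pick a point \<open>u0\<close> of the support. Replacing every slice \<open>k u\<close> by \<open>k u0\<close> makes the defect zero, because then
  both of its terms equal \<open>(\<integral>u. f u) * lam (k u0)\<close>. The replacement changes each of the two terms by at most
  \<open>B * measure M L * e * L1_norm M f\<close>, which explains the factor 2.
\<close>

lemma defect_small_support:
  assumes lam: "L1_functional M lam B" and f: "admissible f" and supp: "\<And>u. f u \<noteq> 0 \<Longrightarrow> u \<in> W"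
    and W: "\<And>u u' x. u \<in> W \<Longrightarrow> u' \<in> W \<Longrightarrow> x \<in> L \<Longrightarrow> norm (k u x - k u' x) \<le> e"
  shows "norm (defect lam f) \<le> 2 * B * measure M L * e * L1_norm M f"
proof (cases "\<exists>u0. f u0 \<noteq> 0")
  case False
  interpret F: L1_functional M lam B by fact
  have "f = (\<lambda>_. 0)" using False by auto
  then have "defect lam f = 0" "L1_norm M f = 0"
    using F.scale[of "\<lambda>_. 0" 0] by (simp_all add: defect_def superpose_def L1_norm_def L1_def)
  then show ?thesis by simp
next
  case True
  interpret F: L1_functional M lam B by fact
  obtain u0 where "f u0 \<noteq> 0" using True by blast
  then have u0: "u0 \<in> A" "u0 \<in> W" using f supp by (auto simp: admissible_def)
  have int: "integrable M f" using f by (simp add: admissible_def)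
  define c where "c = (\<integral>u. f u \<partial>M)"
  define h where "h = (\<lambda>x. superpose f x - c * k u0 x)"
  have L1: "superpose f \<in> L1 M" "k u0 \<in> L1 M" "(\<lambda>x. c * k u0 x) \<in> L1 M"
    using superpose_in_Cc[OF f] slice_in_Cc[OF u0(1)] Cc_subset_L1 by (auto simp: L1_def)
  have h_eq: "h x = (\<integral>u. f u * (k u x - k u0 x) \<partial>M)" for x
    unfolding h_def c_def superpose_def using integrable_slice[OF f] int
    by (simp add: right_diff_distrib)
  have "norm (lam h) \<le> B * (e * L1_norm M f * measure M L)"
  proof (rule small_on_compact_bound[OF lam _ compact_L])
    show "h \<in> borel_measurable M"
      using L1 unfolding h_def by (auto simp: L1_def)
    show "h x = 0" if "x \<notin> L" for x
    proof -
      have "f u * (k u x - k u0 x) = 0" for u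
        using that f kernel_zero[of u x] kernel_zero[of u0 x] u0 by (cases "u \<in> A") (auto simp: admissible_def)
      then show ?thesis
        unfolding h_eq by (simp only: Bochner_Integration.integral_zero)
    qed
    show "norm (h x) \<le> e * L1_norm M f" if "x \<in> L" for x
      unfolding h_eq using int integrable_slice[OF f] supp W u0 that
      by (intro norm_integral_mult_le) (auto simp: right_diff_distrib)
  qed
  moreover have "lam h = lam (superpose f) - c * lam (k u0)"
    unfolding h_def using L1 by (simp add: F.diff F.scale)
  moreover have "norm (\<integral>u. f u * (lam (k u) - lam (k u0)) \<partial>M) \<le> B * (e * measure M L) * L1_norm M f"
    using int integrable_functional_slices[OF lam f] supp u0 W f
    by (intro norm_integral_mult_le functional_slices_close[OF lam])
      (auto simp: right_diff_distrib admissible_def)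
  moreover have "(\<integral>u. f u * (lam (k u) - lam (k u0)) \<partial>M) = (\<integral>u. f u * lam (k u) \<partial>M) - c * lam (k u0)"
    unfolding c_def using int integrable_functional_slices[OF lam f] by (simp add: right_diff_distrib)
  ultimately have "norm (lam (superpose f) - c * lam (k u0)) \<le> B * (e * L1_norm M f * measure M L)"
    "norm ((\<integral>u. f u * lam (k u) \<partial>M) - c * lam (k u0)) \<le> B * (e * measure M L) * L1_norm M f"
    by auto
  from norm_triangle_le_diff[OF add_mono[OF this]] show ?thesis
    by (simp add: defect_def algebra_simps)
qed

lemma defect_add:
  assumes lam: "L1_functional M lam B" and f: "admissible f" and g: "admissible g"
  shows "defect lam (\<lambda>u. f u + g u) = defect lam f + defect lam g"
proof -
  interpret F: L1_functional M lam B by fact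
  have "superpose (\<lambda>u. f u + g u) = (\<lambda>x. superpose f x + superpose g x)"
    using integrable_slice[OF f] integrable_slice[OF g] by (simp add: superpose_def distrib_right)
  moreover have "lam (\<lambda>x. superpose f x + superpose g x) = lam (superpose f) + lam (superpose g)"
    using superpose_in_Cc[OF f] superpose_in_Cc[OF g] Cc_subset_L1 by (intro F.add) auto
  ultimately show ?thesis
    using integrable_functional_slices[OF lam f] integrable_functional_slices[OF lam g]
    by (simp add: defect_def distrib_right)
qed

text \<open>
  Induction on the cover: split off the part of \<open>f\<close> on one open set; the rest is supported
  in the union of the others.
\<close>

lemma defect_finite_cover:
  assumes lam: "L1_functional M lam B" and "finite \<W>"
    and "\<And>W. W \<in> \<W> \<Longrightarrow> open W"
    and "\<And>W u u' x. W \<in> \<W> \<Longrightarrow> u \<in> W \<Longrightarrow> u' \<in> W \<Longrightarrow> x \<in> L \<Longrightarrow> norm (k u x - k u' x) \<le> e"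
    and "admissible f" "\<And>u. f u \<noteq> 0 \<Longrightarrow> u \<in> \<Union>\<W>"
  shows "norm (defect lam f) \<le> 2 * B * measure M L * e * L1_norm M f"
  using assms(2-)
proof (induction \<W> arbitrary: f rule: finite_induct)
  case empty
  then show ?case
    by (intro defect_small_support[OF lam, of f "{}"]) auto
next
  case (insert W \<W>)
  have W: "W \<in> sets M" "- W \<in> sets M"
    using insert.prems(1)[of W] by (simp_all add: borel_comp)
  define f1 where "f1 = (\<lambda>u. indicator W u *\<^sub>R f u)"
  define f2 where "f2 = (\<lambda>u. indicator (- W) u *\<^sub>R f u)"
  have adm: "admissible f1" "admissible f2"
    using insert.prems(3) W unfolding admissible_def f1_def f2_def
    by (auto intro!: integrable_mult_indicator)
  have sum: "f = (\<lambda>u. f1 u + f2 u)"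
    by (auto simp: f1_def f2_def indicator_def)
  have "L1_norm M f = (\<integral>u. norm (f1 u) + norm (f2 u) \<partial>M)"
    unfolding L1_norm_def by (intro Bochner_Integration.integral_cong) (auto simp: f1_def f2_def indicator_def)
  also have "\<dots> = L1_norm M f1 + L1_norm M f2"
    using adm by (simp add: L1_norm_def admissible_def)
  finally have norm: "L1_norm M f = L1_norm M f1 + L1_norm M f2" .
  have "norm (defect lam f1) \<le> 2 * B * measure M L * e * L1_norm M f1"
    using insert.prems(2)[of W]
    by (intro defect_small_support[OF lam adm(1), of W]) (auto simp: f1_def indicator_def split: if_splits)
  moreover have "norm (defect lam f2) \<le> 2 * B * measure M L * e * L1_norm M f2"
  proof (rule insert.IH)
    show "u \<in> \<Union>\<W>" if "f2 u \<noteq> 0" for u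
      using insert.prems(4)[of u] that by (auto simp: f2_def indicator_def split: if_splits)
    show "norm (k u x - k u' x) \<le> e" if "V \<in> \<W>" "u \<in> V" "u' \<in> V" "x \<in> L" for V u u' x
      using insert.prems(2)[of V u u' x] that by simp
  qed (use insert.prems(1) adm in auto)
  moreover have "defect lam f = defect lam f1 + defect lam f2"
    using defect_add[OF lam adm] sum by simp
  ultimately show ?case
    using norm_triangle_ineq[of "defect lam f1" "defect lam f2"] by (simp add: norm distrib_left)
qed

theorem functional_superpose:
  assumes lam: "L1_functional M lam B" and f: "admissible f"
  shows "lam (superpose f) = (\<integral>u. f u * lam (k u) \<partial>M)"
proof -
  interpret F: L1_functional M lam B by fact
  define C where "C = 2 * B * measure M L * L1_norm M f"
  have C: "0 \<le> C"
    using F.nonneg by (simp add: C_def L1_norm_def)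
  have small: "norm (defect lam f) \<le> C * (2 * e)" if e: "0 < e" for e
  proof -
    have "\<exists>W. open W \<and> u0 \<in> W \<and> (\<forall>u\<in>W. \<forall>x\<in>L. norm (k u x - k u0 x) \<le> e)" for u0
      using slices_uniformly_close[OF continuous_kernel compact_L e] by metis
    then obtain W where W: "\<And>u0. open (W u0)" "\<And>u0. u0 \<in> W u0"
      "\<And>u0 u x. u \<in> W u0 \<Longrightarrow> x \<in> L \<Longrightarrow> norm (k u x - k u0 x) \<le> e"
      by metis
    obtain D where D: "D \<subseteq> A" "finite D" "A \<subseteq> (\<Union>u\<in>D. W u)"
      using compactE_image[OF compact_A, of A W] W by blast
    have "norm (defect lam f) \<le> 2 * B * measure M L * (2 * e) * L1_norm M f"
    proof (rule defect_finite_cover[OF lam, of "W ` D"])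
      \<comment> \<open>Two points of \<open>W u0\<close> are compared through \<open>u0\<close>, hence the bound \<open>2 * e\<close>.\<close>
      fix V u u' x
      assume V: "V \<in> W ` D" "u \<in> V" "u' \<in> V" "x \<in> L"
      then obtain u0 where "V = W u0" by blast
      then show "norm (k u x - k u' x) \<le> 2 * e"
        using W(3)[of u u0 x] W(3)[of u' u0 x] V norm_triangle_ineq4[of "k u x - k u0 x" "k u' x - k u0 x"]
        by simp
    qed (use D W f in \<open>auto simp: admissible_def\<close>)
    then show ?thesis by (simp add: C_def mult_ac)
  qed
  have "norm (defect lam f) \<le> 0 + r" if "0 < r" for r
  proof -
    have "norm (defect lam f) \<le> C * (2 * (r / (2 * (C + 1))))"
      using that C by (intro small) simp
    also have "\<dots> \<le> r"
      using that C by (simp add: field_simps)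
    finally show ?thesis by simp
  qed
  then have "norm (defect lam f) \<le> 0"
    by (rule field_le_epsilon)
  then show ?thesis by (simp add: defect_def)
qed

end

section \<open>Haar measure\<close>

lemma open_translate:
  fixes U :: "'a::topological_ab_group_add set"
  assumes "open U"
  shows "open ((+) a ` U)"
proof -
  have "(+) a ` U = (\<lambda>x. x - a) -` U"
    by (auto simp: image_iff intro!: bexI[of _ "_ - a"])
  moreover have "open ((\<lambda>x. x - a) -` U)"
    using assms by (intro open_vimage continuous_intros)
  ultimately show ?thesis by simp
qed

locale haar_group = radon_space M for M :: "'a::{topological_ab_group_add, t2_space} measure" +
  assumes nonzero: "emeasure M UNIV \<noteq> 0"
    and translate: "A \<in> sets borel \<Longrightarrow> emeasure M ((+) a ` A) = emeasure M A"
begin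

lemma measurable_translate [measurable]: "(\<lambda>x. x + a) \<in> measurable M M"
proof -
  have "(\<lambda>x. x + a) \<in> measurable borel borel"
    by (intro borel_measurable_continuous_onI continuous_intros)
  then show ?thesis
    using measurable_cong_sets[OF sets_M sets_M] by blast
qed

lemma distr_translate: "distr M M (\<lambda>x. x + a) = M"
proof (rule measure_eqI)
  fix A assume "A \<in> sets (distr M M (\<lambda>x. x + a))"
  then have A: "A \<in> sets borel" by simp
  have "(\<lambda>x. x + a) -` A = (+) (- a) ` A"
    by (auto simp: image_iff intro!: bexI[of _ "_ + a"])
  then show "emeasure (distr M M (\<lambda>x. x + a)) A = emeasure M A"
    using A translate[OF A, of "- a"] by (simp add: emeasure_distr)
qed simp

lemma integral_translate:
  fixes f :: "'a \<Rightarrow> 'b::{banach, second_countable_topology}"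
  assumes "f \<in> borel_measurable M"
  shows "(\<integral>x. f (x + a) \<partial>M) = (\<integral>x. f x \<partial>M)"
  using integral_distr[OF measurable_translate assms, of a] by (simp add: distr_translate)

lemma integrable_translate:
  fixes f :: "'a \<Rightarrow> 'b::{banach, second_countable_topology}"
  assumes "integrable M f"
  shows "integrable M (\<lambda>x. f (x + a))"
  using integrable_distr[OF measurable_translate, of a f] assms by (simp add: distr_translate)

text \<open>
  If \<open>U\<close> were a null set, then so would be every compact set, being covered by finitely many translates
  of \<open>U\<close>, and by inner regularity the whole group.
\<close>

lemma emeasure_open_nonzero:
  assumes "open U" "U \<noteq> {}"
  shows "emeasure M U \<noteq> 0"
proof
  assume zero: "emeasure M U = 0"
  obtain u where u: "u \<in> U" using assms by blast
  have "emeasure M K = 0" if K: "compact K" for K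
  proof -
    have cover: "K \<subseteq> (\<Union>x\<in>K. (+) (x - u) ` U)"
      using u by (force simp: image_iff)
    obtain D where D: "D \<subseteq> K" "finite D" "K \<subseteq> (\<Union>x\<in>D. (+) (x - u) ` U)"
      using compactE_image[OF K open_translate[OF assms(1)] cover] by metis
    have "(+) (x - u) ` U \<in> null_sets M" for x
      using zero assms(1) open_translate[OF assms(1)] translate[of U "x - u"] by (auto simp: null_sets_def)
    then have "(\<Union>x\<in>D. (+) (x - u) ` U) \<in> null_sets M"
      using D(2) by (intro null_sets.finite_UN) auto
    then have "K \<in> null_sets M"
      using D(3) K by (auto intro: null_sets_subset)
    then show ?thesis by auto
  qed
  then have "(SUP K\<in>{K. compact K \<and> K \<subseteq> UNIV}. emeasure M K) = 0"
    by (intro antisym SUP_least) auto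
  with nonzero inner_regular[of UNIV] show False by simp
qed

text \<open>
  Testing against \<open>f = h * cnj \<psi>\<close>, with \<open>h\<close> a bump at \<open>u\<close>, shows that the nonnegative continuous function
  \<open>h * (cmod \<psi>)\<^sup>2\<close> has integral zero.
\<close>

lemma continuous_eq_zeroI:
  fixes \<psi> :: "'a \<Rightarrow> complex"
  assumes \<psi>: "continuous_on UNIV \<psi>" and zero: "\<And>f. f \<in> Cc \<Longrightarrow> (\<integral>x. f x * \<psi> x \<partial>M) = 0"
  shows "\<psi> u = 0"
proof (rule ccontr)
  assume "\<psi> u \<noteq> 0"
  obtain h L where h: "continuous_on UNIV h" "\<And>x. 0 \<le> h x" "\<And>x. h x \<le> (1::real)"
    "\<And>x. x \<in> {u} \<Longrightarrow> h x = 1" "\<And>x. x \<notin> UNIV \<Longrightarrow> h x = 0" "compact L" "\<And>x. x \<notin> L \<Longrightarrow> h x = 0"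
    using Urysohn_compact_support[OF compact_sing[of u] open_UNIV subset_UNIV] by blast
  define p where "p = (\<lambda>x. h x * (cmod (\<psi> x))\<^sup>2)"
  have p_cont: "continuous_on UNIV p"
    unfolding p_def using h \<psi> by (intro continuous_intros)
  have "(\<lambda>x. h x * cnj (\<psi> x)) \<in> Cc"
    unfolding Cc_def using h \<psi> by (auto intro!: continuous_intros)
  moreover have "complex_of_real (p x) = complex_of_real (h x) * cnj (\<psi> x) * \<psi> x" for x
    by (simp only: p_def of_real_mult complex_norm_square mult_ac)
  ultimately have "(\<integral>x. complex_of_real (p x) \<partial>M) = 0"
    using zero by simp
  then have int0: "(\<integral>x. p x \<partial>M) = 0"
    by simp
  have "p x = 0" if "x \<notin> L" for x
    using h that by (simp add: p_def)
  then have "(\<lambda>x. complex_of_real (p x)) \<in> Cc"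
    unfolding Cc_def using p_cont \<open>compact L\<close> by (auto intro!: continuous_on_of_real)
  then have "integrable M (\<lambda>x. complex_of_real (p x))"
    using Cc_subset_L1 by (auto simp: L1_def)
  from integrable_Re[OF this] have "integrable M p"
    by simp
  then have "AE x in M. p x = 0"
    using int0 h(2) integral_nonneg_eq_0_iff_AE[of M p] by (simp add: p_def)
  moreover have op: "open {x. p x \<noteq> 0}"
    using p_cont by (intro open_Collect_neq) auto
  ultimately have "emeasure M {x. p x \<noteq> 0} = 0"
    using AE_iff_measurable[of "{x. p x \<noteq> 0}" M "\<lambda>x. p x = 0"] by auto
  moreover have "u \<in> {x. p x \<noteq> 0}"
    using \<open>\<psi> u \<noteq> 0\<close> h by (simp add: p_def)
  ultimately show False
    using emeasure_open_nonzero[OF op] by blast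
qed

end

section \<open>Symmetrised translates and the cosine convolution\<close>

definition sym_translate :: "'a::ab_group_add \<Rightarrow> ('a \<Rightarrow> complex) \<Rightarrow> 'a \<Rightarrow> complex" where
  "sym_translate u g = (\<lambda>x. (g (x + u) + g (x - u)) / 2)"

lemma sym_translate_0 [simp]: "sym_translate 0 g = g"
  by (simp add: sym_translate_def)

text \<open>
  The algebraic source of the cosine equation: symmetrised translations multiply like cosines.
\<close>

lemma sym_translate_sym_translate:
  "sym_translate x (sym_translate y g)
    = (\<lambda>t. 1 / 2 * (sym_translate (x + y) g t + sym_translate (x - y) g t))"
  by (auto simp: sym_translate_def algebra_simps add_divide_distrib)

lemma cos_conv_eq: "cos_conv M f g = (\<lambda>x. \<integral>u. f u * sym_translate u g x \<partial>M)"
  by (auto simp: cos_conv_def sym_translate_def)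

context haar_group
begin

lemma sym_translate_compact_kernel:
  assumes "g \<in> Cc" "compact A"
  obtains L where "compact_kernel M (\<lambda>u. sym_translate u g) A L"
proof -
  obtain K where g: "continuous_on UNIV g" and K: "compact K" "\<And>x. x \<notin> K \<Longrightarrow> g x = 0"
    using assms by (auto simp: Cc_def)
  define L where "L = (\<lambda>p. fst p - snd p) ` (K \<times> A) \<union> (\<lambda>p. fst p + snd p) ` (K \<times> A)"
  have "compact L"
    unfolding L_def using K assms
    by (intro compact_Un compact_continuous_image compact_Times continuous_intros)
  moreover have "sym_translate u g x = 0" if "u \<in> A" "x \<notin> L" for u x
  proof -
    have "x + u \<notin> K"
    proof
      assume "x + u \<in> K"
      then have "(\<lambda>p. fst p - snd p) (x + u, u) \<in> L"
        using that(1) unfolding L_def by blast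
      with that(2) show False by simp
    qed
    moreover have "x - u \<notin> K"
    proof
      assume "x - u \<in> K"
      then have "(\<lambda>p. fst p + snd p) (x - u, u) \<in> L"
        using that(1) unfolding L_def by blast
      with that(2) show False by simp
    qed
    ultimately show ?thesis
      using K(2) by (simp add: sym_translate_def)
  qed
  moreover have "continuous_on UNIV (\<lambda>(u, x). sym_translate u g x)"
    unfolding sym_translate_def case_prod_unfold
    by (intro continuous_intros continuous_on_compose2[OF g]) auto
  ultimately have "compact_kernel M (\<lambda>u. sym_translate u g) A L"
    using assms(2) by unfold_locales auto
  then show thesis by (rule that)
qed

lemma sym_translate_in_Cc:
  assumes "(g :: 'a \<Rightarrow> complex) \<in> Cc"
  shows "sym_translate u g \<in> Cc"
proof -
  obtain L where "compact_kernel M (\<lambda>u. sym_translate u g) {u} L"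
    using sym_translate_compact_kernel[OF assms, of "{u}"] by auto
  then show ?thesis
    using compact_kernel.slice_in_Cc by fastforce
qed

lemma L1_norm_sym_translate_le:
  assumes "g \<in> L1 M"
  shows "L1_norm M (sym_translate u g) \<le> L1_norm M g"
proof -
  have g: "integrable M g" using assms by (simp add: L1_def)
  have int: "integrable M (\<lambda>x. g (x + u))" "integrable M (\<lambda>x. g (x - u))"
    using integrable_translate[OF g, of u] integrable_translate[OF g, of "- u"] by simp_all
  have "L1_norm M (sym_translate u g) \<le> (\<integral>x. (norm (g (x + u)) + norm (g (x - u))) / 2 \<partial>M)"
  proof (rule L1_norm_mono)
    show "norm (sym_translate u g x) \<le> (norm (g (x + u)) + norm (g (x - u))) / 2" for x
      using norm_triangle_ineq[of "g (x + u)" "g (x - u)"] by (simp add: sym_translate_def norm_divide)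
  qed (use int in \<open>auto simp: sym_translate_def\<close>)
  also have "\<dots> = ((\<integral>x. norm (g (x + u)) \<partial>M) + (\<integral>x. norm (g (x - u)) \<partial>M)) / 2"
    using int by simp
  also have "\<dots> = L1_norm M g"
    using integral_translate[of "\<lambda>x. norm (g x)" u] integral_translate[of "\<lambda>x. norm (g x)" "- u"] g
    by (simp add: L1_norm_def)
  finally show ?thesis .
qed

text \<open>
  Continuity is local, and locally the parameter \<open>u\<close> ranges over a compact set, where the
  results on compact kernels apply.
\<close>

lemma continuous_functional_sym_translate:
  assumes lam: "L1_functional M lam B" and g: "g \<in> Cc"
  shows "continuous_on UNIV (\<lambda>u. lam (sym_translate u g))"
proof -
  have "isCont (\<lambda>u. lam (sym_translate u g)) u" for u
  proof -
    obtain U A where U: "open U" "compact A" "u \<in> U" "U \<subseteq> A"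
      using locally_compact[unfolded locally_compact_space_def, rule_format, of u] by auto
    obtain L where "compact_kernel M (\<lambda>u. sym_translate u g) A L"
      using sym_translate_compact_kernel[OF g U(2)] by blast
    then have "continuous_on A (\<lambda>u. lam (sym_translate u g))"
      using compact_kernel.continuous_on_functional_slices[OF _ lam] by blast
    then have "continuous_on U (\<lambda>u. lam (sym_translate u g))"
      using U(4) continuous_on_subset by blast
    then show ?thesis
      using U by (simp add: continuous_on_eq_continuous_at)
  qed
  then show ?thesis
    by (simp add: continuous_at_imp_continuous_on)
qed

lemma functional_cos_conv:
  assumes lam: "L1_functional M lam B" and f: "f \<in> Cc" and g: "g \<in> Cc"
  shows "lam (cos_conv M f g) = (\<integral>u. f u * lam (sym_translate u g) \<partial>M)"
proof -
  obtain A where A: "compact A" "\<And>u. u \<notin> A \<Longrightarrow> f u = 0"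
    using f by (auto simp: Cc_def)
  obtain L where "compact_kernel M (\<lambda>u. sym_translate u g) A L"
    using sym_translate_compact_kernel[OF g A(1)] by blast
  then interpret compact_kernel M "\<lambda>u. sym_translate u g" A L .
  have "admissible f"
    using A(2) f Cc_subset_L1 by (auto simp: admissible_def L1_def)
  from functional_superpose[OF lam this] show ?thesis
    by (simp add: superpose_def cos_conv_eq)
qed

lemma integrable_Cc_mult_continuous:
  assumes "f \<in> Cc" "continuous_on UNIV g"
  shows "integrable M (\<lambda>u. f u * g u)"
proof -
  have "(\<lambda>u. f u * g u) \<in> Cc"
    using assms by (auto simp: Cc_def intro!: continuous_intros)
  then show ?thesis using Cc_subset_L1 by (auto simp: L1_def)
qed

lemma integrable_mult_bounded_continuous:
  fixes f g :: "'a \<Rightarrow> complex"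
  assumes f: "integrable M f" and g: "continuous_on UNIV g" "\<And>x. norm (g x) \<le> C"
  shows "integrable M (\<lambda>u. f u * g u)"
proof (rule Bochner_Integration.integrable_bound)
  show "integrable M (\<lambda>u. complex_of_real C * f u)" using f by simp
  have "norm (f u * g u) \<le> norm (complex_of_real C * f u)" for u
    using mult_right_mono[OF order.trans[OF g(2)[of u] abs_ge_self], of "norm (f u)"]
    by (simp add: norm_mult mult.commute)
  then show "AE u in M. norm (f u * g u) \<le> norm (complex_of_real C * f u)" by simp
  show "(\<lambda>u. f u * g u) \<in> borel_measurable M"
    by (rule borel_measurable_times[OF borel_measurable_integrable[OF f] measurable_continuous[OF g(1)]])
qed

section \<open>Multiplicative functionals are cosine transforms\<close>

text \<open>
  The formula \<open>c u = lam (sym_translate u g) / lam g\<close> is forced: if \<open>lam\<close> is integration against a cosine function \<open>\<xi>\<close>,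
  then \<open>lam (sym_translate u g) = \<xi> u * lam g\<close>. So \<open>c\<close> cannot depend on the chosen \<open>g\<close>, and the equation
  \<open>eigen\<close> in the proof is this independence.
\<close>

theorem multiplicative_functional_is_cos_transform:
  assumes lam: "L1_functional M lam B"
    and mult: "\<And>f g. f \<in> Cc \<Longrightarrow> g \<in> Cc \<Longrightarrow> lam (cos_conv M f g) = lam f * lam g"
    and f0: "f0 \<in> L1 M" "lam f0 \<noteq> 0"
  obtains \<xi> where "\<xi> \<in> COS" "\<And>f. f \<in> L1 M \<Longrightarrow> lam f = cos_transform M f \<xi>"
proof -
  interpret F: L1_functional M lam B by fact
  obtain g where g: "g \<in> Cc" "lam g \<noteq> 0"
    using L1_functional_eq_zero[OF lam _ f0(1)] f0(2) by blast
  define c where "c = (\<lambda>u. lam (sym_translate u g) / lam g)"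
  define C where "C = B * L1_norm M g / norm (lam g)"
  have c_cont: "continuous_on UNIV c"
    unfolding c_def using continuous_functional_sym_translate[OF lam g(1)] g(2)
    by (intro continuous_intros) auto
  have c_bound: "norm (c u) \<le> C" for u
  proof -
    have "norm (lam (sym_translate u g)) \<le> B * L1_norm M (sym_translate u g)"
      using sym_translate_in_Cc[OF g(1)] Cc_subset_L1 by (intro F.bound) auto
    also have "\<dots> \<le> B * L1_norm M g"
      using g(1) Cc_subset_L1 F.nonneg by (intro mult_left_mono L1_norm_sym_translate_le) auto
    finally show ?thesis
      by (simp add: c_def C_def norm_divide divide_right_mono)
  qed
  have "c \<in> bcontfun"
    using c_cont c_bound by (rule bcontfun_normI)
  then have apply_c: "apply_bcontfun (Bcontfun c) = c"
    by (simp add: Bcontfun_inverse)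
  have int_c: "integrable M (\<lambda>u. f u * c u)" if "f \<in> L1 M" for f
    using that c_cont c_bound by (intro integrable_mult_bounded_continuous) (auto simp: L1_def)
  have rep_Cc: "lam f = (\<integral>u. f u * c u \<partial>M)" if "f \<in> Cc" for f
    using mult[OF that g(1)] functional_cos_conv[OF lam that g(1)] g(2) by (simp add: c_def field_simps)
  have rep: "lam f = (\<integral>u. f u * c u \<partial>M)" if "f \<in> L1 M" for f
  proof -
    \<comment> \<open>The difference of the two sides is a bounded functional that vanishes on \<open>Cc\<close>.\<close>
    have "L1_functional M (\<lambda>f. lam f - (\<integral>u. f u * c u \<partial>M)) (B + C)"
    proof
      fix f h and a :: complex
      assume f: "f \<in> L1 M"
      show "lam (\<lambda>x. a * f x) - (\<integral>u. a * f u * c u \<partial>M) = a * (lam f - (\<integral>u. f u * c u \<partial>M))"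
        using int_c[OF f] F.scale[OF f] by (simp add: mult.assoc right_diff_distrib)
      have "norm (\<integral>u. f u * c u \<partial>M) \<le> C * L1_norm M f"
        using f int_c[OF f] c_bound by (intro norm_integral_mult_le) (auto simp: L1_def)
      with F.bound[OF f] show "norm (lam f - (\<integral>u. f u * c u \<partial>M)) \<le> (B + C) * L1_norm M f"
        using norm_triangle_ineq4[of "lam f" "\<integral>u. f u * c u \<partial>M"] by (simp add: distrib_right)
      assume h: "h \<in> L1 M"
      show "lam (\<lambda>x. f x + h x) - (\<integral>u. (f u + h u) * c u \<partial>M)
          = lam f - (\<integral>u. f u * c u \<partial>M) + (lam h - (\<integral>u. h u * c u \<partial>M))"
        using F.add[OF f h] int_c[OF f] int_c[OF h] by (simp add: distrib_right)
    next
      show "0 \<le> B + C"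
        using F.nonneg order.trans[OF norm_ge_zero c_bound] by auto
    qed
    from L1_functional_eq_zero[OF this _ that] rep_Cc show ?thesis by simp
  qed
  have eigen: "lam (sym_translate u h) = c u * lam h" if h: "h \<in> Cc" for u h
  proof -
    have cont: "continuous_on UNIV (\<lambda>u. lam (sym_translate u h))"
      by (rule continuous_functional_sym_translate[OF lam h])
    have "lam (sym_translate u h) - c u * lam h = 0"
    proof (rule continuous_eq_zeroI)
      show "continuous_on UNIV (\<lambda>u. lam (sym_translate u h) - c u * lam h)"
        by (intro continuous_intros cont c_cont)
      fix f :: "'a \<Rightarrow> complex" assume f: "f \<in> Cc"
      have "(\<integral>u. f u * (lam (sym_translate u h) - c u * lam h) \<partial>M)
          = (\<integral>u. f u * lam (sym_translate u h) \<partial>M) - (\<integral>u. f u * c u \<partial>M) * lam h"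
        using integrable_Cc_mult_continuous[OF f cont] integrable_Cc_mult_continuous[OF f c_cont]
        by (simp add: right_diff_distrib flip: mult.assoc)
      also have "\<dots> = 0"
        using functional_cos_conv[OF lam f h] mult[OF f h] rep_Cc[OF f] by simp
      finally show "(\<integral>u. f u * (lam (sym_translate u h) - c u * lam h) \<partial>M) = 0" .
    qed
    then show ?thesis by simp
  qed
  have dAlembert: "c x * c y = (c (x + y) + c (x - y)) / 2" for x y
  proof -
    \<comment> \<open>Evaluate \<open>lam\<close> at \<open>sym_translate x (sym_translate y g)\<close> in two ways: by \<open>eigen\<close> applied twice, and
        after expanding the iterated translate.\<close>
    have L1: "sym_translate u g \<in> L1 M" for u
      using sym_translate_in_Cc[OF g(1)] Cc_subset_L1 by blast
    have L1': "(\<lambda>t. sym_translate (x + y) g t + sym_translate (x - y) g t) \<in> L1 M"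
      using L1[of "x + y"] L1[of "x - y"] by (simp add: L1_def)
    have "c x * (c y * lam g) = lam (sym_translate x (sym_translate y g))"
      using eigen[OF g(1), of y] eigen[OF sym_translate_in_Cc[OF g(1)], of x y] by simp
    also have "\<dots> = 1 / 2 * (lam (sym_translate (x + y) g) + lam (sym_translate (x - y) g))"
      unfolding sym_translate_sym_translate F.scale[OF L1'] F.add[OF L1 L1] ..
    also have "\<dots> = (c (x + y) + c (x - y)) / 2 * lam g"
      using eigen[OF g(1)] by (simp add: distrib_right add_divide_distrib)
    finally show ?thesis
      using g(2) by (metis (no_types, lifting) mult.assoc mult_right_cancel)
  qed
  have "c 0 = 1"
    using g(2) by (simp add: c_def)
  then have "Bcontfun c \<noteq> 0"
    using apply_c by (metis zero_bcontfun.rep_eq zero_neq_one)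
  then have "Bcontfun c \<in> COS"
    using dAlembert by (simp add: COS_def apply_c)
  moreover have "lam f = cos_transform M f (Bcontfun c)" if "f \<in> L1 M" for f
    using rep[OF that] by (simp add: cos_transform_def apply_c)
  ultimately show thesis by (rule that)
qed

end

section \<open>Operators from integrable functions to bounded functions on cosines\<close>

theorem theorem5:
  fixes \<mu> :: "'a::{topological_ab_group_add, t2_space} measure"
    and T :: "('a \<Rightarrow> complex) \<Rightarrow> ('a \<Rightarrow>\<^sub>C complex) \<Rightarrow> complex"
  assumes "locally_compact_space (euclidean :: 'a topology)"
    and "haar_measure \<mu>"
    and "bounded_linear_L1_Linf \<mu> T"
    and "\<forall>f\<in>L1 \<mu>. \<forall>g\<in>L1 \<mu>. \<forall>\<phi>\<in>COS. T (cos_conv \<mu> f g) \<phi> = T f \<phi> * T g \<phi>"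
  shows "\<exists>\<theta> :: ('a \<Rightarrow>\<^sub>C complex) \<Rightarrow> ('a \<Rightarrow>\<^sub>C complex).
           (\<forall>\<phi>\<in>COS. \<theta> \<phi> \<in> COS \<union> {0}) \<and>
           (\<forall>f\<in>L1 \<mu>. \<forall>\<phi>\<in>COS. T f \<phi> = cos_transform \<mu> f (\<theta> \<phi>)) \<and>
           (\<forall>\<phi>\<in>COS. \<theta> \<phi> = 0 \<longleftrightarrow> (\<forall>f\<in>L1 \<mu>. T f \<phi> = 0))"
proof -
  have sets: "sets \<mu> = sets borel"
    using assms(2) by (simp add: haar_measure_def)
  then have space: "space \<mu> = UNIV"
    using sets_eq_imp_space_eq[OF sets] by simp
  interpret haar_group \<mu>
  proof
    note haar = assms(2)[unfolded haar_measure_def sets space]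
    show "locally_compact_space (euclidean :: 'a topology)" by (fact assms(1))
    show "sets \<mu> = sets borel" by (fact sets)
    show "emeasure \<mu> K < \<infinity>" if "compact K" for K
      using haar that by blast
    show "emeasure \<mu> A = (INF U\<in>{U. open U \<and> A \<subseteq> U}. emeasure \<mu> U)" if "A \<in> sets borel" for A
      using haar that by blast
    show "emeasure \<mu> U = (SUP K\<in>{K. compact K \<and> K \<subseteq> U}. emeasure \<mu> K)" if "open U" for U
      using haar that by blast
    show "emeasure \<mu> UNIV \<noteq> 0"
      using haar by blast
    show "emeasure \<mu> ((+) a ` A) = emeasure \<mu> A" if "A \<in> sets borel" for a A
      using haar that by blast
  qed
  note T = assms(3)[unfolded bounded_linear_L1_Linf_def]
  then obtain B where B: "\<forall>f\<in>L1 \<mu>. (SUP \<phi>\<in>COS. norm (T f \<phi>)) \<le> B * L1_norm \<mu> f"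
    by (elim conjE exE)
  have lam: "L1_functional \<mu> (\<lambda>f. T f \<phi>) \<bar>B\<bar>" if \<phi>: "\<phi> \<in> COS" for \<phi>
  proof
    fix f g and a :: complex
    assume f: "f \<in> L1 \<mu>"
    show "T (\<lambda>x. a * f x) \<phi> = a * T f \<phi>"
      using T f \<phi> by blast
    have "bounded (T f ` COS)"
      using T f by blast
    then have "bdd_above ((\<lambda>\<phi>. norm (T f \<phi>)) ` COS)"
      by (auto simp: bounded_iff bdd_above_def)
    then have "norm (T f \<phi>) \<le> (SUP \<phi>\<in>COS. norm (T f \<phi>))"
      using \<phi> by (intro cSUP_upper)
    also have "\<dots> \<le> B * L1_norm \<mu> f"
      using B f by blast
    also have "\<dots> \<le> \<bar>B\<bar> * L1_norm \<mu> f"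
      by (intro mult_right_mono) (auto simp: L1_norm_def)
    finally show "norm (T f \<phi>) \<le> \<bar>B\<bar> * L1_norm \<mu> f" .
    assume g: "g \<in> L1 \<mu>"
    show "T (\<lambda>x. f x + g x) \<phi> = T f \<phi> + T g \<phi>"
      using T f g \<phi> by blast
  qed simp
  have "\<exists>\<xi>. \<xi> \<in> COS \<union> {0} \<and> (\<forall>f\<in>L1 \<mu>. T f \<phi> = cos_transform \<mu> f \<xi>) \<and>
      (\<xi> = 0 \<longleftrightarrow> (\<forall>f\<in>L1 \<mu>. T f \<phi> = 0))" if \<phi>: "\<phi> \<in> COS" for \<phi>
  proof (cases "\<forall>f\<in>L1 \<mu>. T f \<phi> = 0")
    case True
    then show ?thesis
      by (intro exI[of _ 0]) (simp add: cos_transform_def)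
  next
    case False
    then obtain f0 where f0: "f0 \<in> L1 \<mu>" "T f0 \<phi> \<noteq> 0" by blast
    have "T (cos_conv \<mu> f g) \<phi> = T f \<phi> * T g \<phi>" if "f \<in> Cc" "g \<in> Cc" for f g
      using assms(4) \<phi> that Cc_subset_L1 by blast
    from multiplicative_functional_is_cos_transform[OF lam[OF \<phi>] this f0]
    obtain \<xi> where "\<xi> \<in> COS" "\<And>f. f \<in> L1 \<mu> \<Longrightarrow> T f \<phi> = cos_transform \<mu> f \<xi>"
      by blast
    moreover have "\<xi> \<noteq> 0"
      using \<open>\<xi> \<in> COS\<close> by (simp add: COS_def)
    ultimately show ?thesis
      using False by blast
  qed
  then show ?thesis
    by metis
qed

end
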